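(* Let $\alpha>\tfrac12$. Any algorithm for maximizing a function $f$ under a knapsack constraint that outputs an $\alpha$-approximation with constant probability and only queries values of $f$ on feasible sets (sets of cost at most $K$) must make $\Omega(n^2)$ queries, in each of the following cases for the class of functions $f$: (1) $f$ is non-monotone submodular; (2) $f$ is monotone and submodular on the feasible sets; (3) $f$ is monotone subadditive.
   Context: Knapsack-constrained maximization: given $n$ items $e_1,\dots,e_n$ with costs $c(e_i)$, a capacity $K$, and value-oracle access to a set function $f$ on subsets of the items, find a set $S$ with $c(S)=\sum_{e\in S}c(e)\le K$ (a feasible set) maximizing $f(S)$. An $\alpha$-approximation is a feasible output $S$ with $f(S)\ge\alpha\max_{T\text{ feasible}}f(T)$. $f$ is submodular if $f(T\cup\{e\})-f(T)\le f(S\cup\{e\})-f(S)$ for all $S\subseteq T$ and $e$; monotone if $f(S)\le f(T)$ for $S\subseteq T$; subadditive if $f(S)+f(T)\ge f(S\cup T)$ for all $S,T$. The lower bound holds for some family of instances in each class (for all sufficiently large $n$). *)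

theory Defs
  imports "HOL-Probability.Probability"
begin

text \<open>The items are \<open>1, \<dots>, n\<close>, with costs \<open>c\<close> and capacity \<open>K\<close>; only the values of a set function
  on subsets of \<open>{1..n}\<close> matter.\<close>

definition feasible :: "nat \<Rightarrow> (nat \<Rightarrow> real) \<Rightarrow> real \<Rightarrow> nat set \<Rightarrow> bool" where
  "feasible n c K S \<longleftrightarrow> S \<subseteq> {1..n} \<and> sum c S \<le> K"

text \<open>Values are non-negative, as usual for multiplicative approximation: if the optimum were negative
  and \<open>\<alpha> < 1\<close>, not even an optimal set would be an \<open>\<alpha>\<close>-approximation.\<close>

definition knapsack_instance ::
  "nat \<Rightarrow> (nat \<Rightarrow> real) \<Rightarrow> real \<Rightarrow> (nat set \<Rightarrow> real) \<Rightarrow> bool" where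
  "knapsack_instance n c K f \<longleftrightarrow>
     (\<forall>e\<in>{1..n}. c e > 0) \<and> K > 0 \<and> (\<forall>S\<subseteq>{1..n}. f S \<ge> 0)"

definition is_approximation ::
  "real \<Rightarrow> nat \<Rightarrow> (nat \<Rightarrow> real) \<Rightarrow> real \<Rightarrow> (nat set \<Rightarrow> real) \<Rightarrow> nat set \<Rightarrow> bool" where
  "is_approximation \<alpha> n c K f S \<longleftrightarrow>
     feasible n c K S \<and> f S \<ge> \<alpha> * Max (f ` {T. feasible n c K T})"

definition monotone_setfun :: "nat \<Rightarrow> (nat set \<Rightarrow> real) \<Rightarrow> bool" where
  "monotone_setfun n f \<longleftrightarrow> (\<forall>S T. S \<subseteq> T \<and> T \<subseteq> {1..n} \<longrightarrow> f S \<le> f T)"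

text \<open>The new item \<open>e\<close> is taken outside \<open>T\<close>: allowing \<open>e \<in> T - S\<close> would force monotonicity.\<close>

definition submodular_setfun :: "nat \<Rightarrow> (nat set \<Rightarrow> real) \<Rightarrow> bool" where
  "submodular_setfun n f \<longleftrightarrow>
     (\<forall>S T e. S \<subseteq> T \<and> T \<subseteq> {1..n} \<and> e \<in> {1..n} - T \<longrightarrow>
        f (insert e T) - f T \<le> f (insert e S) - f S)"

text \<open>With positive costs, feasibility of \<open>insert e T\<close> makes all four sets feasible.\<close>

definition submodular_on_feasible ::
  "nat \<Rightarrow> (nat \<Rightarrow> real) \<Rightarrow> real \<Rightarrow> (nat set \<Rightarrow> real) \<Rightarrow> bool" where
  "submodular_on_feasible n c K f \<longleftrightarrow>
     (\<forall>S T e. S \<subseteq> T \<and> e \<notin> T \<and> feasible n c K (insert e T) \<longrightarrow>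
        f (insert e T) - f T \<le> f (insert e S) - f S)"

definition subadditive_setfun :: "nat \<Rightarrow> (nat set \<Rightarrow> real) \<Rightarrow> bool" where
  "subadditive_setfun n f \<longleftrightarrow>
     (\<forall>S T. S \<subseteq> {1..n} \<and> T \<subseteq> {1..n} \<longrightarrow> f S + f T \<ge> f (S \<union> T))"

type_synonym instance_class = "nat \<Rightarrow> (nat \<Rightarrow> real) \<Rightarrow> real \<Rightarrow> (nat set \<Rightarrow> real) \<Rightarrow> bool"

definition nonmonotone_submodular :: instance_class where
  "nonmonotone_submodular n c K f \<longleftrightarrow>
     knapsack_instance n c K f \<and> submodular_setfun n f \<and> \<not> monotone_setfun n f"

definition monotone_feasibly_submodular :: instance_class where
  "monotone_feasibly_submodular n c K f \<longleftrightarrow>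
     knapsack_instance n c K f \<and> monotone_setfun n f \<and> submodular_on_feasible n c K f"

definition monotone_subadditive :: instance_class where
  "monotone_subadditive n c K f \<longleftrightarrow>
     knapsack_instance n c K f \<and> monotone_setfun n f \<and> subadditive_setfun n f"

text \<open>A deterministic adaptive algorithm is a decision tree: it either outputs a set, or queries the
  value of a set and continues depending on the answer.\<close>

datatype query_alg = Output "nat set" | Query "nat set" "real \<Rightarrow> query_alg"

primrec alg_output :: "(nat set \<Rightarrow> real) \<Rightarrow> query_alg \<Rightarrow> nat set" where
  "alg_output f (Output S) = S"
| "alg_output f (Query S k) = alg_output f (k (f S))"

primrec alg_queries :: "(nat set \<Rightarrow> real) \<Rightarrow> query_alg \<Rightarrow> nat set list" where
  "alg_queries f (Output S) = []"
| "alg_queries f (Query S k) = S # alg_queries f (k (f S))"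

text \<open>A randomized algorithm knows \<open>n\<close>, \<open>c\<close> and \<open>K\<close>, and is given by a probability measure on
  deterministic algorithms. The sigma-algebra is arbitrary, so any source of randomness is covered
  by pushing it forward to decision trees.\<close>

type_synonym randomized_alg = "nat \<Rightarrow> (nat \<Rightarrow> real) \<Rightarrow> real \<Rightarrow> query_alg measure"

definition approximates_with_prob ::
  "real \<Rightarrow> real \<Rightarrow> instance_class \<Rightarrow> randomized_alg \<Rightarrow> bool" where
  "approximates_with_prob \<alpha> p F A \<longleftrightarrow>
     (\<forall>n c K f. F n c K f \<longrightarrow>
        prob_space (A n c K) \<and>
        {D \<in> space (A n c K). is_approximation \<alpha> n c K f (alg_output f D)} \<in> sets (A n c K) \<and>
        measure (A n c K) {D \<in> space (A n c K). is_approximation \<alpha> n c K f (alg_output f D)} \<ge> p)"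

definition queries_only_feasible :: "instance_class \<Rightarrow> randomized_alg \<Rightarrow> bool" where
  "queries_only_feasible F A \<longleftrightarrow>
     (\<forall>n c K f. F n c K f \<longrightarrow>
        (AE D in A n c K. \<forall>S\<in>set (alg_queries f D). feasible n c K S))"

text \<open>Worst case over the randomness: the algorithm does not almost surely get by with fewer than
  \<open>q\<close> queries.\<close>

definition may_need_queries ::
  "randomized_alg \<Rightarrow> nat \<Rightarrow> (nat \<Rightarrow> real) \<Rightarrow> real \<Rightarrow> (nat set \<Rightarrow> real) \<Rightarrow> real \<Rightarrow> bool" where
  "may_need_queries A n c K f q \<longleftrightarrow>
     \<not> (AE D in A n c K. real (length (alg_queries f D)) < q)"

end

theory Submission
  imports Defs
begin

text \<open>In each case a base instance \<open>g\<close> is hidden among many perturbations \<open>f i\<close>, such that every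
  feasible set tells only a small fraction of the \<open>f i\<close> apart from \<open>g\<close> and no set on which \<open>f i\<close> and
  \<open>g\<close> agree is good for \<open>f i\<close>. A run with few queries on \<open>g\<close> behaves identically on most \<open>f i\<close>, so
  averaging its success probability over \<open>i\<close> forces many queries on \<open>g\<close>.

  For the monotone classes, at most two items fit into the knapsack, singletons and pairs have value
  1, and one hidden pair has value 2. For non-negative submodular functions this does not work;
  instead, following Feige, Mirrokni and Vondrak, all sets are feasible, \<open>g\<close> is the cut function
  \<open>|S| (n - |S|)\<close> of the complete graph, and the perturbation adds
  \<open>(max 0 (||S \<inter> C| - |S - C|| - \<epsilon> n))\<^sup>2\<close> for a hidden set \<open>C\<close>. This almost doubles the maximum, but
  by a fourth moment bound a given set \<open>S\<close> notices only an \<open>O(1/n\<^sup>2)\<close> fraction of all \<open>C\<close>.\<close>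

section \<open>Averaging over hidden instances\<close>

lemma alg_output_cong:
  assumes "\<And>S. S \<in> set (alg_queries g D) \<Longrightarrow> f S = g S"
  shows "alg_output f D = alg_output g D"
  using assms by (induction D) auto

text \<open>A tree making fewer than \<open>q\<close> queries on \<open>g\<close> can succeed on
  \<open>f i\<close> only if one of these queries, or its output on \<open>g\<close>, separates
  \<open>f i\<close> from \<open>g\<close>. So almost surely it succeeds on at most
  \<open>(q + 1) * B\<close> indices, while the expected number of successes is at least
  \<open>p * card I\<close>, contradicting \<open>less\<close>.\<close>

lemma may_need_queries_hidden:
  fixes f :: "'i \<Rightarrow> nat set \<Rightarrow> real"
  assumes A: "approximates_with_prob \<alpha> p F A" "queries_only_feasible F A"
    and I: "finite I" and Ff: "\<And>i. i \<in> I \<Longrightarrow> F n c K (f i)" and Fg: "F n c K g"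
    and bad: "\<And>i S. \<lbrakk>i \<in> I; feasible n c K S; f i S = g S\<rbrakk> \<Longrightarrow> \<not> is_approximation \<alpha> n c K (f i) S"
    and B: "\<And>S. feasible n c K S \<Longrightarrow> real (card {i \<in> I. f i S \<noteq> g S}) \<le> B" "0 \<le> B"
    and less: "(q + 1) * B < p * real (card I)"
  shows "may_need_queries A n c K g q"
  unfolding may_need_queries_def
proof
  define M where "M = A n c K"
  assume "AE D in A n c K. real (length (alg_queries g D)) < q"
  then have short: "AE D in M. real (length (alg_queries g D)) < q"
    unfolding M_def .
  have feas: "AE D in M. \<forall>S\<in>set (alg_queries g D). feasible n c K S"
    using A(2) Fg unfolding queries_only_feasible_def M_def by blast
  interpret prob_space M
    using A(1) Fg unfolding approximates_with_prob_def M_def by blast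
  define E where "E i = {D \<in> space M. is_approximation \<alpha> n c K (f i) (alg_output (f i) D)}" for i
  have E: "E i \<in> events" "p \<le> prob (E i)" if "i \<in> I" for i
    using A(1) Ff[OF that] unfolding approximates_with_prob_def M_def E_def by blast+
  have "AE D in M. (\<Sum>i\<in>I. indicator (E i) D) \<le> (q + 1) * B"
    using short feas
  proof eventually_elim
    case (elim D)
    \<comment> \<open>The output counts as one more tested set, hence \<open>q + 1\<close>. Keeping
      only feasible sets makes the bound \<open>B\<close> applicable and loses nothing: queries are
      almost surely feasible, and so is a successful output.\<close>
    define Q where "Q = {S \<in> insert (alg_output g D) (set (alg_queries g D)). feasible n c K S}"
    have "finite Q" unfolding Q_def by auto
    have "card Q \<le> card (insert (alg_output g D) (set (alg_queries g D)))"
      unfolding Q_def by (intro card_mono) auto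
    also have "\<dots> \<le> Suc (length (alg_queries g D))"
      using card_length[of "alg_output g D # alg_queries g D"] by simp
    finally have cardQ: "real (card Q) \<le> q + 1"
      using elim(1) by linarith
    have sub: "{i \<in> I. D \<in> E i} \<subseteq> (\<Union>S\<in>Q. {i \<in> I. f i S \<noteq> g S})"
    proof clarify
      fix i assume i: "i \<in> I" "D \<in> E i"
      show "i \<in> (\<Union>S\<in>Q. {i \<in> I. f i S \<noteq> g S})"
      \<comment> \<open>If no query separates the two functions, both runs end in the same output,
        and by \<open>bad\<close> that output separates them.\<close>
      proof (cases "\<forall>S\<in>set (alg_queries g D). f i S = g S")
        case True
        then have "alg_output (f i) D = alg_output g D"
          by (intro alg_output_cong) auto
        then have appr: "is_approximation \<alpha> n c K (f i) (alg_output g D)"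
          using i(2) by (simp add: E_def)
        then have "feasible n c K (alg_output g D)"
          by (simp add: is_approximation_def)
        with bad[OF i(1)] appr i(1) show ?thesis
          unfolding Q_def by blast
      next
        case False
        then show ?thesis using elim(2) i(1) unfolding Q_def by blast
      qed
    qed
    have "(\<Sum>i\<in>I. indicator (E i) D) = (\<Sum>i\<in>I. if D \<in> E i then 1 else 0 :: real)"
      by (intro sum.cong) auto
    also have "\<dots> = (\<Sum>i\<in>{i \<in> I. D \<in> E i}. 1)"
      by (rule sum.inter_filter[OF I, symmetric])
    also have "\<dots> = real (card {i \<in> I. D \<in> E i})"
      by simp
    also have "card {i \<in> I. D \<in> E i} \<le> card (\<Union>S\<in>Q. {i \<in> I. f i S \<noteq> g S})"
      using \<open>finite Q\<close> I by (intro card_mono[OF _ sub]) auto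
    also have "\<dots> \<le> (\<Sum>S\<in>Q. card {i \<in> I. f i S \<noteq> g S})"
      by (rule card_UN_le[OF \<open>finite Q\<close>])
    also have "real \<dots> = (\<Sum>S\<in>Q. real (card {i \<in> I. f i S \<noteq> g S}))"
      by simp
    also have "\<dots> \<le> (\<Sum>S\<in>Q. B)"
      by (intro sum_mono B(1)) (simp add: Q_def)
    also have "\<dots> \<le> (q + 1) * B"
      using cardQ B(2) by (simp add: mult_right_mono)
    finally show ?case by simp
  qed
  moreover have int: "integrable M (indicat_real (E i))" if "i \<in> I" for i
    using E(1)[OF that] by (intro integrable_real_indicator) (auto simp: less_top[symmetric])
  ultimately have "expectation (\<lambda>D. \<Sum>i\<in>I. indicator (E i) D) \<le> (q + 1) * B"
    by (intro integral_le_const Bochner_Integration.integrable_sum)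
  also have "expectation (\<lambda>D. \<Sum>i\<in>I. indicator (E i) D) = (\<Sum>i\<in>I. prob (E i))"
    using E(1) int by (subst Bochner_Integration.integral_sum) auto
  finally have "(\<Sum>i\<in>I. prob (E i)) \<le> (q + 1) * B" .
  moreover have "p * real (card I) \<le> (\<Sum>i\<in>I. prob (E i))"
    using sum_mono[of I "\<lambda>_. p" "\<lambda>i. prob (E i)"] E(2) by (simp add: mult.commute)
  ultimately show False
    using less by linarith
qed

lemma finite_feasible: "finite {T. feasible n c K T}"
  by (rule finite_subset[of _ "Pow {1..n}"]) (auto simp: feasible_def)

lemma not_is_approximationI:
  assumes "feasible n c K T" "f S < \<alpha> * f T" "0 \<le> \<alpha>"
  shows "\<not> is_approximation \<alpha> n c K f S"
proof -
  have "f T \<le> Max (f ` {T. feasible n c K T})"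
    using assms(1) finite_feasible by (intro Max_ge) auto
  with assms(2,3) have "f S < \<alpha> * Max (f ` {T. feasible n c K T})"
    by (meson less_le_trans mult_left_mono)
  then show ?thesis by (simp add: is_approximation_def)
qed

section \<open>Monotone instances with a hidden pair\<close>

text \<open>Sets of three or more items exceed capacity 2; they get value 2 so that raising a single
  pair to 2 preserves monotonicity. Emptiness is tested directly because an infinite set has
  \<open>card\<close> 0 and should still get value at least 1.\<close>

definition rank2 :: "nat set \<Rightarrow> real" where
  "rank2 S = (if S = {} then 0 else if card S \<le> 2 then 1 else 2)"

definition hidden_pair :: "nat set \<Rightarrow> nat set \<Rightarrow> real" where
  "hidden_pair P = rank2(P := 2)"

lemma feasible_unit: "feasible n (\<lambda>_. 1) K S \<longleftrightarrow> S \<subseteq> {1..n} \<and> real (card S) \<le> K"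
  by (auto simp: feasible_def)

text \<open>Subadditivity: two nonempty sets contribute at least 1 each, and no value exceeds 2.
  Submodularity on feasible sets: only pairs fit, so the one nontrivial case is
  \<open>S = {}\<close> and \<open>T = {t}\<close>, where the gain is at most 2 - 1 on the left and
  exactly 1 on the right.\<close>

lemma hidden_pair_classesI:
  assumes mono: "\<And>S T. \<lbrakk>S \<subseteq> T; finite T\<rbrakk> \<Longrightarrow> f S \<le> f T"
    and f: "f {} = 0" "\<And>S. S \<noteq> {} \<Longrightarrow> 1 \<le> f S" "\<And>S. f S \<le> 2" "\<And>e. f {e} = 1"
  shows "monotone_feasibly_submodular n (\<lambda>_. 1) 2 f"
    and "monotone_subadditive n (\<lambda>_. 1) 2 f"
proof -
  have nn: "0 \<le> f S" for S
    using f(1) f(2)[of S] by (cases "S = {}") auto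
  have inst: "knapsack_instance n (\<lambda>_. 1) 2 f" "monotone_setfun n f"
    using nn mono by (auto simp: knapsack_instance_def monotone_setfun_def intro: finite_subset)
  have "f (insert e T) - f T \<le> f (insert e S) - f S"
    if "S \<subseteq> T" "e \<notin> T" "feasible n (\<lambda>_. 1) 2 (insert e T)" for S T e
  proof -
    have "finite T"
      using that(3) by (auto simp: feasible_unit dest: finite_subset)
    moreover have "card T \<le> 1"
      using that(2,3) \<open>finite T\<close> by (simp add: feasible_unit)
    ultimately consider "T = {}" | t where "T = {t}"
      by (metis card_0_eq card_1_singletonE le_Suc_eq le_zero_eq One_nat_def)
    then show ?thesis
    proof cases
      case 2
      then have "S = {} \<or> S = T" using that(1) by auto
      then show ?thesis using f(1,4) f(3)[of "insert e T"] 2 by auto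
    qed (use that(1) in auto)
  qed
  then show "monotone_feasibly_submodular n (\<lambda>_. 1) 2 f"
    unfolding monotone_feasibly_submodular_def submodular_on_feasible_def using inst by blast
  have "f (S \<union> T) \<le> f S + f T" for S T
    using f(1) f(2)[of S] f(2)[of T] f(3)[of "S \<union> T"] by (cases "S = {}"; cases "T = {}") auto
  then show "monotone_subadditive n (\<lambda>_. 1) 2 f"
    unfolding monotone_subadditive_def subadditive_setfun_def using inst by simp
qed

lemma rank2_mono: "\<lbrakk>S \<subseteq> T; finite T\<rbrakk> \<Longrightarrow> rank2 S \<le> rank2 T"
  using card_mono[of T S] by (auto simp: rank2_def)

lemma rank2_class:
  "monotone_feasibly_submodular n (\<lambda>_. 1) 2 rank2"
  "monotone_subadditive n (\<lambda>_. 1) 2 rank2"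
  by (rule hidden_pair_classesI; use rank2_mono in \<open>auto simp: rank2_def\<close>)+

text \<open>The raised value could only hurt when passing from \<open>P\<close> to a proper
  superset, which has at least three items and hence value 2 as well.\<close>

lemma hidden_pair_mono:
  assumes "card P = 2" "S \<subseteq> T" "finite T"
  shows "hidden_pair P S \<le> hidden_pair P T"
proof (cases "S = P \<and> T \<noteq> P")
  case True
  then have "card T > 2"
    using assms psubset_card_mono[of T S] by auto
  then show ?thesis using True by (auto simp: hidden_pair_def rank2_def)
next
  case False
  moreover have "rank2 S \<le> 2" by (simp add: rank2_def)
  ultimately show ?thesis
    using rank2_mono[OF assms(2,3)] by (auto simp: hidden_pair_def)
qed

lemma hidden_pair_class:
  assumes "card P = 2"
  shows "monotone_feasibly_submodular n (\<lambda>_. 1) 2 (hidden_pair P)"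
    and "monotone_subadditive n (\<lambda>_. 1) 2 (hidden_pair P)"
  by (rule hidden_pair_classesI;
      use hidden_pair_mono[OF assms] assms in \<open>auto simp: hidden_pair_def rank2_def\<close>)+

text \<open>Stated for a generic class \<open>F\<close>, as both monotone classes use the same
  instances. A feasible set other than \<open>P\<close> has value at most 1, less than
  \<open>\<alpha> * 2\<close>, and a set \<open>S\<close> separates at most the one instance with
  \<open>P = S\<close>, so \<open>B = 1\<close>.\<close>

lemma hidden_pair_lower_bound:
  assumes "1 / 2 < \<alpha>" "0 < p"
    and F: "\<And>n. F n (\<lambda>_. 1) 2 rank2"
      "\<And>n P. card P = 2 \<Longrightarrow> F n (\<lambda>_. 1) 2 (hidden_pair P)"
  shows "\<exists>C>0. \<exists>N. \<forall>A. approximates_with_prob \<alpha> p F A \<and> queries_only_feasible F A \<longrightarrow>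
      (\<forall>n\<ge>N. \<exists>c K f. F n c K f \<and> may_need_queries A n c K f (C * real n ^ 2))"
proof (intro exI conjI allI impI)
  \<comment> \<open>There are \<open>n * (n - 1) / 2\<close> hidden pairs; \<open>p / 8\<close>
    leaves \<open>3 * p / 8\<close> of the quadratic term to absorb \<open>1 + p * n / 2\<close>,
    which the threshold \<open>4 + 1 / p\<close> for \<open>n\<close> makes possible.\<close>
  show "0 < p / 8" using assms by simp
  fix A n assume A: "approximates_with_prob \<alpha> p F A \<and> queries_only_feasible F A"
    and n: "4 + nat \<lceil>1 / p\<rceil> \<le> n"
  let ?I = "{P. P \<subseteq> {1..n} \<and> card P = 2}"
  show "F n (\<lambda>_. 1) 2 rank2" by (rule F)
  have n4: "4 \<le> real n" using n by linarith
  have "1 / p < real n" using n by linarith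
  then have np: "1 < real n * p" using assms(2) by (simp add: field_simps)
  have card_I: "real (card ?I) = real n * (real n - 1) / 2"
    using n by (subst n_subsets) (auto simp: choose_two real_of_nat_div of_nat_diff)
  have "1 + p * real n / 2 < 3 * p * (real n)\<^sup>2 / 8"
  proof -
    have "p * real n * 4 \<le> p * real n * real n"
      using n4 assms(2) by (intro mult_left_mono) auto
    then have "p * real n * 4 \<le> p * (real n)\<^sup>2" by (simp add: power2_eq_square)
    then show ?thesis using np by (simp add: mult.commute)
  qed
  then have less: "(p / 8 * (real n)\<^sup>2 + 1) * 1 < p * real (card ?I)"
    unfolding card_I by (simp add: algebra_simps power2_eq_square)
  show "may_need_queries A n (\<lambda>_. 1) 2 rank2 (p / 8 * real n ^ 2)"
  proof (rule may_need_queries_hidden[where F = F and I = ?I and f = hidden_pair and B = 1, OF _ _ _ _ _ _ _ _ less])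
    show "finite ?I" by (rule finite_subset[of _ "Pow {1..n}"]) auto
    show "\<not> is_approximation \<alpha> n (\<lambda>_. 1) 2 (hidden_pair P) S"
      if "P \<in> ?I" "feasible n (\<lambda>_. 1) 2 S" "hidden_pair P S = rank2 S" for P S
    proof (rule not_is_approximationI)
      show "feasible n (\<lambda>_. 1) 2 P" using that(1) by (simp add: feasible_unit)
      have "rank2 S \<le> 1" using that(2) by (auto simp: rank2_def feasible_unit)
      then show "hidden_pair P S < \<alpha> * hidden_pair P P"
        using assms(1) that(3) by (simp add: hidden_pair_def)
    qed (use assms in simp)
    show "real (card {P \<in> ?I. hidden_pair P S \<noteq> rank2 S}) \<le> 1" for S
    proof -
      have "card {P \<in> ?I. hidden_pair P S \<noteq> rank2 S} \<le> card {S}"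
        by (intro card_mono) (auto simp: hidden_pair_def split: if_splits)
      then show ?thesis by simp
    qed
  qed (use A F in auto)
qed

section \<open>Submodular instances with a hidden cut\<close>

text \<open>Squaring the hinge makes it differentiable with a slope that is Lipschitz with constant
  2, just what the curvature of \<open>cut_value\<close> can compensate.\<close>

definition excess :: "real \<Rightarrow> real \<Rightarrow> real" where
  "excess t x = (max 0 (\<bar>x\<bar> - t))\<^sup>2"

definition imbalance :: "nat set \<Rightarrow> nat set \<Rightarrow> real" where
  "imbalance C S = (\<Sum>e\<in>S. if e \<in> C then 1 else - 1)"

definition cut_value :: "nat \<Rightarrow> nat set \<Rightarrow> real" where
  "cut_value n S = real (card S) * (real n - real (card S))"

definition hidden_cut :: "real \<Rightarrow> nat \<Rightarrow> nat set \<Rightarrow> nat set \<Rightarrow> real" where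
  "hidden_cut t n C S = cut_value n S + excess t (imbalance C S)"

section \<open>Smoothness of the squared hinge\<close>

lemma has_real_derivative_max_0_power2:
  "((\<lambda>x. (max 0 x)\<^sup>2) has_real_derivative 2 * max 0 x) (at x)" for x :: real
proof -
  consider "x < 0" | "x > 0" | "x = 0" by linarith
  then show ?thesis
  proof cases
    case 1
    have "((\<lambda>x. 0) has_real_derivative 2 * max 0 x) (at x)" using 1 by simp
    then show ?thesis
      by (rule has_field_derivative_transform_within_open[where S = "{..<0}"]) (use 1 in auto)
  next
    case 2
    have "((\<lambda>x. x\<^sup>2) has_real_derivative 2 * max 0 x) (at x)"
      using 2 by (auto intro!: derivative_eq_intros)
    then show ?thesis
      by (rule has_field_derivative_transform_within_open[where S = "{0<..}"]) (use 2 in auto)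
  next
    case 3
    \<comment> \<open>At \<open>h = 0\<close> this relies on division by zero yielding 0.\<close>
    have "(max 0 h)\<^sup>2 / h = max 0 h" for h :: real
      by (simp add: max_def power2_eq_square)
    moreover have "((\<lambda>h::real. max 0 h) \<longlongrightarrow> max 0 0) (at 0)"
      by (intro tendsto_intros)
    ultimately show ?thesis using 3 by (simp add: DERIV_def)
  qed
qed

text \<open>For \<open>0 \<le> t\<close> at most one of the two one-sided hinges is nonzero. Without
  the absolute value, the derivative can be taken term by term.\<close>

lemma excess_eq:
  assumes "0 \<le> t"
  shows "excess t x = (max 0 (x - t))\<^sup>2 + (max 0 (- x - t))\<^sup>2"
  using assms by (auto simp: excess_def max_def abs_if)

lemma excess_minus: "excess t (- x) = excess t x"
  by (simp add: excess_def)

lemma has_real_derivative_excess: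
  assumes "0 \<le> t"
  shows "(excess t has_real_derivative 2 * max 0 (x - t) - 2 * max 0 (- x - t)) (at x)"
proof -
  have "((\<lambda>x. (max 0 (x - t))\<^sup>2) has_real_derivative 2 * max 0 (x - t) * 1) (at x)"
    by (rule DERIV_chain2[OF has_real_derivative_max_0_power2]) (auto intro!: derivative_eq_intros)
  moreover have "((\<lambda>x. (max 0 (- x - t))\<^sup>2) has_real_derivative 2 * max 0 (- x - t) * - 1) (at x)"
    by (rule DERIV_chain2[OF has_real_derivative_max_0_power2]) (auto intro!: derivative_eq_intros)
  ultimately show ?thesis
    unfolding excess_eq[OF assms, abs_def] by (auto dest: DERIV_add)
qed

text \<open>The derivative of \<open>excess t\<close> increases at a rate between 0 and 2.\<close>

lemma excess_increment:
  assumes "0 \<le> t"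
  shows "(excess t (y + 1) - excess t y) - (excess t (x + 1) - excess t x) \<le> 2 * max 0 (y - x)"
proof -
  define u where "u z = 2 * max 0 (z - t) - 2 * max 0 (- z - t)" for z
  define h where "h z = excess t (z + 1) - excess t z" for z
  have h: "(h has_real_derivative u (z + 1) - u z) (at z)" for z
  proof -
    have u: "(excess t has_real_derivative u z) (at z)" for z
      unfolding u_def by (rule has_real_derivative_excess[OF assms])
    have "((\<lambda>z. excess t (z + 1)) has_real_derivative u (z + 1)) (at z)"
      using u[of "z + 1"] by (subst (asm) DERIV_shift)
    then show ?thesis
      unfolding h_def[abs_def] by (intro DERIV_diff u)
  qed
  have u: "0 \<le> u (z + 1) - u z" "u (z + 1) - u z \<le> 2" for z
    using assms unfolding u_def by (auto simp: max_def)
  \<comment> \<open>For \<open>x \<le> y\<close> the increment \<open>h\<close> grows at rate at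
    most 2; otherwise \<open>h\<close> being nondecreasing makes the left side at most 0.\<close>
  show ?thesis
  proof (cases "x \<le> y")
    case True
    have "2 * x - h x \<le> 2 * y - h y"
    proof (rule DERIV_nonneg_imp_nondecreasing[OF True])
      fix z
      have "((\<lambda>z. 2 * z - h z) has_real_derivative 2 - (u (z + 1) - u z)) (at z)"
        using DERIV_diff[OF DERIV_cmult_Id h] by simp
      then show "\<exists>y. ((\<lambda>z. 2 * z - h z) has_real_derivative y) (at z) \<and> 0 \<le> y"
        using u(2)[of z] by (intro exI conjI) auto
    qed
    then show ?thesis using True by (simp add: h_def)
  next
    case False
    then have "h y \<le> h x"
      by (intro DERIV_nonneg_imp_nondecreasing[of y x h] exI conjI, simp) (rule h u(1))+
    then show ?thesis using False by (simp add: h_def)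
  qed
qed

section \<open>Submodularity of the cut function and its perturbation\<close>

lemma imbalance_insert:
  assumes "finite T" "e \<notin> T"
  shows "imbalance C (insert e T) = imbalance C T + (if e \<in> C then 1 else - 1)"
  using assms by (simp add: imbalance_def)

lemma imbalance_diff_le:
  assumes "finite T" "S \<subseteq> T"
  shows "\<bar>imbalance C T - imbalance C S\<bar> \<le> real (card T) - real (card S)"
proof -
  have "imbalance C T - imbalance C S = (\<Sum>e\<in>T - S. if e \<in> C then 1 else - 1)"
    using assms by (simp add: imbalance_def sum_diff)
  also have "\<bar>\<dots>\<bar> \<le> (\<Sum>e\<in>T - S. \<bar>if e \<in> C then 1 else - 1\<bar>)" by (rule sum_abs)
  also have "\<dots> = real (card (T - S))" by (simp add: if_distrib cong: if_cong)
  finally show ?thesis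
    using assms card_mono[OF assms] by (simp add: card_Diff_subset finite_subset of_nat_diff)
qed

lemma cut_value_insert:
  assumes "finite T" "e \<notin> T"
  shows "cut_value n (insert e T) - cut_value n T = real n - 1 - 2 * real (card T)"
  using assms by (simp add: cut_value_def algebra_simps)

lemma submodular_cut_value: "submodular_setfun n (cut_value n)"
  unfolding submodular_setfun_def
proof (intro allI impI)
  fix S T e assume *: "S \<subseteq> T \<and> T \<subseteq> {1..n} \<and> e \<in> {1..n} - T"
  then have "finite T" "finite S" "card S \<le> card T"
    by (auto intro: finite_subset card_mono)
  then show "cut_value n (insert e T) - cut_value n T \<le> cut_value n (insert e S) - cut_value n S"
    using * by (subst (1 2) cut_value_insert) auto
qed

text \<open>From \<open>S\<close> to \<open>T\<close> the marginal gain of \<open>cut_value\<close>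
  drops by exactly \<open>2 * (card T - card S)\<close>. The gain of the perturbation rises by at
  most twice the change of imbalance, which is no larger.\<close>

lemma submodular_hidden_cut:
  assumes "0 \<le> t"
  shows "submodular_setfun n (hidden_cut t n C)"
  unfolding submodular_setfun_def
proof (intro allI impI)
  fix S T e assume *: "S \<subseteq> T \<and> T \<subseteq> {1..n} \<and> e \<in> {1..n} - T"
  then have fin: "finite T" "finite S" "card S \<le> card T" "e \<notin> T" "e \<notin> S"
    by (auto intro: finite_subset card_mono)
  let ?x = "imbalance C S" and ?y = "imbalance C T"
  have d: "\<bar>?y - ?x\<bar> \<le> real (card T) - real (card S)"
    using * fin by (intro imbalance_diff_le) auto
  have "(excess t (imbalance C (insert e T)) - excess t ?y) -
      (excess t (imbalance C (insert e S)) - excess t ?x) \<le> 2 * (real (card T) - real (card S))"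
  proof (cases "e \<in> C")
    case True
    then show ?thesis
      using excess_increment[OF assms, of ?y ?x] d fin by (simp add: imbalance_insert max_def split: if_splits)
  next
    case False
    \<comment> \<open>An item outside \<open>C\<close> moves the imbalance down; evenness of
      \<open>excess\<close> reflects this into an upward step.\<close>
    have "excess t (z - 1) = excess t (- z + 1)" "excess t z = excess t (- z)" for z
      using excess_minus[of t "z - 1"] excess_minus[of t z] by simp_all
    then show ?thesis
      using excess_increment[OF assms, of "- ?y" "- ?x"] d fin False
      by (simp add: imbalance_insert max_def split: if_splits)
  qed
  then show "hidden_cut t n C (insert e T) - hidden_cut t n C T
      \<le> hidden_cut t n C (insert e S) - hidden_cut t n C S"
    using cut_value_insert[OF fin(1,4), of n] cut_value_insert[OF fin(2,5), of n]
    by (simp add: hidden_cut_def algebra_simps)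
qed

section \<open>Value bounds and non-monotonicity\<close>

lemma cut_value_nonneg: "S \<subseteq> {1..n} \<Longrightarrow> 0 \<le> cut_value n S"
  using card_mono[of "{1..n}" S] by (simp add: cut_value_def)

lemma cut_value_le: "cut_value n S \<le> (real n)\<^sup>2 / 4"
  using zero_le_power2[of "real n - 2 * real (card S)"]
  by (simp add: cut_value_def power2_eq_square algebra_simps)

lemma not_monotone_setfunI:
  "\<lbrakk>S \<subseteq> T; T \<subseteq> {1..n}; f T < f S\<rbrakk> \<Longrightarrow> \<not> monotone_setfun n f"
  by (auto simp: monotone_setfun_def not_le)

lemma nonmonotone_cut_value:
  assumes "2 \<le> n"
  shows "nonmonotone_submodular n (\<lambda>_. 1) (real n) (cut_value n)"
proof -
  have "cut_value n {1} > cut_value n {1..n}"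
    using assms by (simp add: cut_value_def)
  then have "\<not> monotone_setfun n (cut_value n)"
    using assms by (intro not_monotone_setfunI) auto
  then show ?thesis
    using assms cut_value_nonneg submodular_cut_value
    by (simp add: nonmonotone_submodular_def knapsack_instance_def)
qed

text \<open>If \<open>C\<close> nearly bisects the items, the perturbation vanishes on the full set,
  whose value is then 0, while a singleton has positive value.\<close>

lemma nonmonotone_hidden_cut:
  assumes "2 \<le> n" "0 \<le> t" "\<bar>imbalance C {1..n}\<bar> \<le> t"
  shows "nonmonotone_submodular n (\<lambda>_. 1) (real n) (hidden_cut t n C)"
proof -
  have "hidden_cut t n C {1..n} = 0"
    using assms(3) by (simp add: hidden_cut_def cut_value_def excess_def max_def)
  moreover have "0 < cut_value n {1}"
    using assms(1) by (simp add: cut_value_def)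
  then have "0 < hidden_cut t n C {1}"
    by (simp add: hidden_cut_def excess_def add_pos_nonneg)
  ultimately have "\<not> monotone_setfun n (hidden_cut t n C)"
    using assms(1) by (intro not_monotone_setfunI[of "{1}" "{1..n}"]) auto
  then show ?thesis
    using assms cut_value_nonneg submodular_hidden_cut
    by (simp add: nonmonotone_submodular_def knapsack_instance_def hidden_cut_def excess_def)
qed

text \<open>Take the larger of \<open>C\<close> and its complement, with
  \<open>m \<ge> n / 2\<close> items: its imbalance is \<open>m\<close> in absolute value, and its
  total value is \<open>(1 - 2 * \<epsilon>) * n * m + (\<epsilon> * n)^2\<close>. This is almost
  twice the maximum \<open>n^2 / 4\<close> allowed by \<open>cut_value_le\<close>.\<close>

lemma hidden_cut_large:
  assumes "C \<subseteq> {1..n}" "0 \<le> \<epsilon>" "\<epsilon> \<le> 1 / 2"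
  obtains T where "T \<subseteq> {1..n}" "(1 - 2 * \<epsilon>) * (real n)\<^sup>2 / 2 \<le> hidden_cut (\<epsilon> * real n) n C T"
proof -
  have fin: "finite C" using assms(1) by (rule finite_subset) simp
  have le: "card C \<le> n" using card_mono[OF _ assms(1)] by simp
  note large = that
  have *: thesis if T: "T \<subseteq> {1..n}" "\<bar>imbalance C T\<bar> = real (card T)" "real n / 2 \<le> real (card T)" for T
  proof (rule large[OF T(1)])
    define m where "m = real (card T)"
    have "\<epsilon> * real n \<le> m"
      using T(3) mult_right_mono[OF assms(3), of "real n"] by (simp add: m_def)
    then have "hidden_cut (\<epsilon> * real n) n C T = m * (real n - m) + (m - \<epsilon> * real n)\<^sup>2"
      using T(2) by (simp add: hidden_cut_def excess_def cut_value_def m_def)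
    also have "\<dots> = (1 - 2 * \<epsilon>) * real n * m + (\<epsilon> * real n)\<^sup>2"
      by (simp add: power2_eq_square algebra_simps)
    also have "\<dots> \<ge> (1 - 2 * \<epsilon>) * real n * (real n / 2)"
      using T(3) assms by (intro add_increasing2 mult_left_mono) (auto simp: m_def)
    finally show "(1 - 2 * \<epsilon>) * (real n)\<^sup>2 / 2 \<le> hidden_cut (\<epsilon> * real n) n C T"
      by (simp add: power2_eq_square mult.assoc)
  qed
  show thesis
  proof (cases "real n / 2 \<le> real (card C)")
    case True
    then show ?thesis using assms(1) by (intro *[of C]) (simp_all add: imbalance_def)
  next
    case False
    have "imbalance C ({1..n} - C) = - real (card ({1..n} - C))"
      unfolding imbalance_def by (subst sum.cong[OF refl, of _ _ "\<lambda>_. - 1"]) auto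
    moreover have "real (card ({1..n} - C)) = real n - real (card C)"
      using assms(1) fin le by (simp add: card_Diff_subset of_nat_diff)
    ultimately show ?thesis using False by (intro *[of "{1..n} - C"]) auto
  qed
qed

section \<open>Moments and tails of the imbalance over all hidden sets\<close>

lemma sum_Pow_insert:
  assumes "finite A" "x \<notin> A"
  shows "(\<Sum>C\<in>Pow (insert x A). h C) = (\<Sum>C\<in>Pow A. h C + h (insert x C))"
proof -
  have "inj_on (insert x) (Pow A)"
    using assms(2) by (auto simp: inj_on_def)
  moreover have "Pow A \<inter> insert x ` Pow A = {}"
    using assms(2) by auto
  ultimately show ?thesis
    using assms(1) by (simp add: Pow_insert sum.union_disjoint sum.reindex sum.distrib)
qed

text \<open>For uniformly random \<open>C\<close> the imbalance is a simple random walk with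
  \<open>card S\<close> steps. Pairing \<open>C\<close> with \<open>insert x C\<close> replaces
  \<open>z\<close> by \<open>z - 1\<close> and \<open>z + 1\<close>, and
  \<open>(z - 1)^4 + (z + 1)^4 = 2 * z^4 + 12 * z^2 + 2\<close>; hence the induction for the fourth
  moment needs the second one.\<close>

lemma imbalance_moments:
  assumes "finite S"
  shows "(\<Sum>C\<in>Pow S. (imbalance C S)\<^sup>2) = 2 ^ card S * real (card S)"
    and "(\<Sum>C\<in>Pow S. imbalance C S ^ 4) \<le> 2 ^ card S * (3 * (real (card S))\<^sup>2)"
  using assms
proof (induction S)
  case (insert x S)
  have eq: "imbalance C (insert x S) = imbalance C S - 1"
    "imbalance (insert x C) (insert x S) = imbalance C S + 1" if "C \<in> Pow S" for C
  proof -
    have "imbalance (insert x C) S = imbalance C S"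
      unfolding imbalance_def using insert.hyps by (intro sum.cong) auto
    then show "imbalance C (insert x S) = imbalance C S - 1"
      "imbalance (insert x C) (insert x S) = imbalance C S + 1"
      using that insert.hyps by (auto simp: imbalance_insert)
  qed
  have card_Pow_S: "(\<Sum>C\<in>Pow S. 1) = (2::real) ^ card S"
    using insert.hyps by (simp add: card_Pow)
  {
    case 1
    have "(\<Sum>C\<in>Pow (insert x S). (imbalance C (insert x S))\<^sup>2)
        = (\<Sum>C\<in>Pow S. 2 * (imbalance C S)\<^sup>2 + 2 * 1)"
      unfolding sum_Pow_insert[OF insert.hyps]
      by (intro sum.cong refl) (simp add: eq power2_eq_square algebra_simps)
    also have "\<dots> = 2 * (\<Sum>C\<in>Pow S. (imbalance C S)\<^sup>2) + 2 * (\<Sum>C\<in>Pow S. 1)"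
      by (simp only: sum.distrib sum_distrib_left)
    finally show ?case
      unfolding insert.IH(1) card_Pow_S using insert.hyps by (simp add: algebra_simps)
  next
    case 2
    have "(\<Sum>C\<in>Pow (insert x S). imbalance C (insert x S) ^ 4)
        = (\<Sum>C\<in>Pow S. 2 * imbalance C S ^ 4 + (12 * (imbalance C S)\<^sup>2 + 2 * 1))"
      unfolding sum_Pow_insert[OF insert.hyps]
      by (intro sum.cong refl) (simp add: eq power2_eq_square power4_eq_xxxx algebra_simps)
    also have "\<dots> = 2 * (\<Sum>C\<in>Pow S. imbalance C S ^ 4) +
        (12 * (\<Sum>C\<in>Pow S. (imbalance C S)\<^sup>2) + 2 * (\<Sum>C\<in>Pow S. 1))"
      by (simp only: sum.distrib sum_distrib_left)
    also have "\<dots> \<le> 2 * (2 ^ card S * (3 * (real (card S))\<^sup>2)) +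
        (12 * (2 ^ card S * real (card S)) + 2 * 2 ^ card S)"
      unfolding insert.IH(1) card_Pow_S using insert.IH(2) by simp
    also have "\<dots> = 2 ^ card S * (6 * (real (card S))\<^sup>2 + 12 * real (card S) + 2)"
      by (simp add: algebra_simps)
    also have "\<dots> \<le> 2 ^ card S * (6 * (real (card S) + 1)\<^sup>2)"
      by (intro mult_left_mono) (simp_all add: power2_eq_square algebra_simps)
    finally show ?case
      using insert.hyps by (simp add: algebra_simps)
  }
qed (simp_all add: imbalance_def)

text \<open>Whether \<open>C\<close> contains an item outside \<open>S\<close> does not affect the
  imbalance, so each such item just doubles both sides.\<close>

lemma imbalance_fourth_moment:
  assumes "finite A" "S \<subseteq> A"
  shows "(\<Sum>C\<in>Pow A. imbalance C S ^ 4) \<le> 2 ^ card A * (3 * (real (card S))\<^sup>2)"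
proof -
  have "finite S" using assms by (rule finite_subset[rotated])
  have "(\<Sum>C\<in>Pow (S \<union> R). imbalance C S ^ 4) \<le> 2 ^ card (S \<union> R) * (3 * (real (card S))\<^sup>2)"
    if "finite R" "R \<inter> S = {}" for R
    using that
  proof (induction R)
    case empty
    then show ?case using imbalance_moments(2)[OF \<open>finite S\<close>] by simp
  next
    case (insert x R)
    have "imbalance (insert x C) S = imbalance C S" for C
      unfolding imbalance_def using insert.prems by (intro sum.cong) auto
    moreover have "x \<notin> S \<union> R" "finite (S \<union> R)"
      using insert.hyps insert.prems \<open>finite S\<close> by auto
    ultimately have "(\<Sum>C\<in>Pow (S \<union> insert x R). imbalance C S ^ 4)
        = 2 * (\<Sum>C\<in>Pow (S \<union> R). imbalance C S ^ 4)" "card (S \<union> insert x R) = Suc (card (S \<union> R))"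
      by (simp_all add: sum_Pow_insert sum_distrib_left)
    then show ?case
      using insert by (simp add: algebra_simps)
  qed
  from this[of "A - S"] assms show ?thesis
    by (simp add: Un_absorb1 Int_commute)
qed

text \<open>Markov's inequality for the fourth power. The second moment would only bound the
  fraction by order \<open>1 / n\<close>, giving a linear query bound.\<close>

lemma card_imbalance_gt:
  assumes "S \<subseteq> {1..n}" "0 < \<epsilon>" "0 < n"
  shows "real (card {C \<in> Pow {1..n}. \<epsilon> * real n < \<bar>imbalance C S\<bar>})
    \<le> 3 * 2 ^ n / (\<epsilon> ^ 4 * (real n)\<^sup>2)"
proof -
  let ?X = "{C \<in> Pow {1..n}. \<epsilon> * real n < \<bar>imbalance C S\<bar>}"
  have "real (card ?X) * (\<epsilon> * real n) ^ 4 = (\<Sum>C\<in>?X. (\<epsilon> * real n) ^ 4)" by simp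
  also have "\<dots> \<le> (\<Sum>C\<in>?X. imbalance C S ^ 4)"
  proof (rule sum_mono)
    fix C assume "C \<in> ?X"
    then have "(\<epsilon> * real n) ^ 4 \<le> \<bar>imbalance C S\<bar> ^ 4"
      using assms(2) by (intro power_mono) auto
    then show "(\<epsilon> * real n) ^ 4 \<le> imbalance C S ^ 4" by (simp add: power_even_abs)
  qed
  also have "\<dots> \<le> (\<Sum>C\<in>Pow {1..n}. imbalance C S ^ 4)"
    by (intro sum_mono2) auto
  also have "\<dots> \<le> 2 ^ card {1..n} * (3 * (real (card S))\<^sup>2)"
    using assms(1) by (intro imbalance_fourth_moment) auto
  also have "\<dots> \<le> 2 ^ n * (3 * (real n)\<^sup>2)"
    using card_mono[OF _ assms(1)] by (simp add: power_mono)
  finally have "real (card ?X) * (\<epsilon> ^ 4 * (real n)\<^sup>2) * (real n)\<^sup>2 \<le> (3 * 2 ^ n) * (real n)\<^sup>2"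
    by (simp add: power_mult_distrib power2_eq_square power4_eq_xxxx mult_ac)
  then have "real (card ?X) * (\<epsilon> ^ 4 * (real n)\<^sup>2) \<le> 3 * 2 ^ n"
    using assms(3) by (simp add: mult_le_cancel_right)
  then show ?thesis using assms(2,3) by (simp add: pos_le_divide_eq)
qed

section \<open>Constants and the quadratic bound for submodular instances\<close>

lemma hidden_cut_lower_bound:
  assumes "1 / 2 < \<alpha>" "0 < p"
  shows "\<exists>C>0. \<exists>N. \<forall>A. approximates_with_prob \<alpha> p nonmonotone_submodular A \<and>
      queries_only_feasible nonmonotone_submodular A \<longrightarrow>
      (\<forall>n\<ge>N. \<exists>c K f. nonmonotone_submodular n c K f \<and> may_need_queries A n c K f (C * real n ^ 2))"
proof (intro exI conjI allI impI)
  \<comment> \<open>This choice gives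
    \<open>\<alpha> * (1 - 2 * \<epsilon>) = \<alpha> / 2 + 1 / 4\<close>, which exceeds 1/2 exactly
    because \<open>\<alpha> > 1 / 2\<close>.\<close>
  define \<epsilon> where "\<epsilon> = (2 * \<alpha> - 1) / (8 * \<alpha>)"
  have \<epsilon>: "0 < \<epsilon>" "\<epsilon> \<le> 1 / 2" "1 / 2 < \<alpha> * (1 - 2 * \<epsilon>)"
    using assms by (simp_all add: \<epsilon>_def field_simps)
  define c where "c = p * \<epsilon> ^ 4"
  have c: "0 < c" using assms(2) \<epsilon>(1) by (simp add: c_def)
  then show "0 < c / 6" by simp
  fix A n
  assume A: "approximates_with_prob \<alpha> p nonmonotone_submodular A \<and>
      queries_only_feasible nonmonotone_submodular A"
    and n: "2 + nat \<lceil>6 * (1 + p) / c\<rceil> \<le> n"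
  have n2: "2 \<le> n" using n by linarith
  show "nonmonotone_submodular n (\<lambda>_. 1) (real n) (cut_value n)"
    by (rule nonmonotone_cut_value[OF n2])
  define t where "t = \<epsilon> * real n"
  have t: "0 \<le> t" using \<epsilon>(1) by (simp add: t_def)
  define B where "B = 3 * 2 ^ n / (\<epsilon> ^ 4 * (real n)\<^sup>2)"
  \<comment> \<open>Only near-bisections are used, so that every perturbed instance is non-monotone;
    by \<open>few\<close> for the full set this discards at most \<open>B\<close> of the
    \<open>2 ^ n\<close> sets.\<close>
  define I where "I = {C \<in> Pow {1..n}. \<bar>imbalance C {1..n}\<bar> \<le> t}"
  have few: "real (card {C \<in> Pow {1..n}. t < \<bar>imbalance C S\<bar>}) \<le> B" if "S \<subseteq> {1..n}" for S
    unfolding t_def B_def using card_imbalance_gt[OF that \<epsilon>(1)] n2 by simp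
  have "card (Pow {1..n}) \<le> card I + card {C \<in> Pow {1..n}. t < \<bar>imbalance C {1..n}\<bar>}"
    unfolding I_def by (rule order.trans[OF card_mono card_Un_le]) auto
  then have "2 ^ n \<le> card I + card {C \<in> Pow {1..n}. t < \<bar>imbalance C {1..n}\<bar>}"
    by (simp add: card_Pow)
  then have "real (2 ^ n) \<le> real (card I + card {C \<in> Pow {1..n}. t < \<bar>imbalance C {1..n}\<bar>})"
    by (simp only: of_nat_le_iff)
  then have card_I: "2 ^ n - B \<le> real (card I)"
    using few[of "{1..n}"] by simp
  \<comment> \<open>Multiplied out, the claim is \<open>3 * (c / 6 * n^2 + 1 + p) < c * n^2\<close>:
    the factor \<open>c / 6\<close> uses half of the right side, and the threshold on
    \<open>n\<close> makes the other half exceed \<open>3 * (1 + p)\<close>.\<close>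
  have less: "(c / 6 * (real n)\<^sup>2 + 1) * B < p * real (card I)"
  proof -
    have "6 * (1 + p) / c < real n" using n by linarith
    also have "\<dots> \<le> (real n)\<^sup>2" using n2 by (simp add: power2_eq_square)
    finally have "6 * (1 + p) < c * (real n)\<^sup>2"
      using c by (simp add: pos_divide_less_eq mult.commute)
    then have "3 * (c / 6 * (real n)\<^sup>2 + 1 + p) < c * (real n)\<^sup>2" by simp
    then have "2 ^ n * (3 * (c / 6 * (real n)\<^sup>2 + 1 + p)) < 2 ^ n * (c * (real n)\<^sup>2)" by simp
    then have "(c / 6 * (real n)\<^sup>2 + 1 + p) * (3 * 2 ^ n) < p * 2 ^ n * (\<epsilon> ^ 4 * (real n)\<^sup>2)"
      by (simp add: c_def mult_ac)
    then have "(c / 6 * (real n)\<^sup>2 + 1 + p) * B < p * 2 ^ n"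
      using \<epsilon>(1) n2 by (simp add: B_def pos_divide_less_eq)
    then have "(c / 6 * (real n)\<^sup>2 + 1) * B < p * (2 ^ n - B)"
      by (simp add: algebra_simps)
    also have "\<dots> \<le> p * real (card I)"
      using card_I assms(2) by simp
    finally show ?thesis .
  qed
  show "may_need_queries A n (\<lambda>_. 1) (real n) (cut_value n) (c / 6 * real n ^ 2)"
  proof (rule may_need_queries_hidden[where F = nonmonotone_submodular and I = I and f = "hidden_cut t n", OF _ _ _ _ _ _ _ _ less])
    show "finite I" by (simp add: I_def)
    show "nonmonotone_submodular n (\<lambda>_. 1) (real n) (hidden_cut t n C)" if "C \<in> I" for C
      using that t n2 by (intro nonmonotone_hidden_cut) (auto simp: I_def)
    show "\<not> is_approximation \<alpha> n (\<lambda>_. 1) (real n) (hidden_cut t n C) S"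
      if C: "C \<in> I" and S: "hidden_cut t n C S = cut_value n S" for C S
    proof -
      obtain T where T: "T \<subseteq> {1..n}" "(1 - 2 * \<epsilon>) * (real n)\<^sup>2 / 2 \<le> hidden_cut t n C T"
        using hidden_cut_large[of C n \<epsilon>] C \<epsilon> unfolding I_def t_def by auto
      have "hidden_cut t n C S \<le> 1 / 2 * ((real n)\<^sup>2 / 2)"
        unfolding S using cut_value_le[of n S] by simp
      also have "\<dots> < \<alpha> * (1 - 2 * \<epsilon>) * ((real n)\<^sup>2 / 2)"
        using \<epsilon>(3) n2 by (intro mult_strict_right_mono) auto
      also have "\<dots> \<le> \<alpha> * hidden_cut t n C T"
        using T(2) assms(1) by (simp add: mult.assoc)
      finally show ?thesis
        using T(1) card_mono[OF _ T(1)] assms(1)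
        by (intro not_is_approximationI[of n _ _ T]) (auto simp: feasible_unit)
    qed
    show "real (card {C \<in> I. hidden_cut t n C S \<noteq> cut_value n S}) \<le> B"
      if "feasible n (\<lambda>_. 1) (real n) S" for S
    proof -
      have "card {C \<in> I. hidden_cut t n C S \<noteq> cut_value n S}
          \<le> card {C \<in> Pow {1..n}. t < \<bar>imbalance C S\<bar>}"
        \<comment> \<open>The perturbation is nonzero only where the imbalance exceeds
          \<open>t\<close>.\<close>
        by (intro card_mono) (auto simp: I_def hidden_cut_def excess_def max_def split: if_splits)
      with few[of S] that show ?thesis by (simp add: feasible_def)
    qed
    show "0 \<le> B" using \<epsilon>(1) by (simp add: B_def)
  qed (use A nonmonotone_cut_value[OF n2] in auto)
qed

theorem theorem11:
  fixes \<alpha> p :: real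
  assumes "\<alpha> > 1 / 2" and "p > 0"
  shows "\<forall>F \<in> {nonmonotone_submodular, monotone_feasibly_submodular, monotone_subadditive}.
    \<exists>C>0. \<exists>N. \<forall>A. approximates_with_prob \<alpha> p F A \<and> queries_only_feasible F A \<longrightarrow>
      (\<forall>n\<ge>N. \<exists>c K f. F n c K f \<and> may_need_queries A n c K f (C * real n ^ 2))"
  using hidden_cut_lower_bound[OF assms]
    hidden_pair_lower_bound[where F = monotone_feasibly_submodular,
      OF assms rank2_class(1) hidden_pair_class(1)]
    hidden_pair_lower_bound[where F = monotone_subadditive,
      OF assms rank2_class(2) hidden_pair_class(2)]
  by simp

end
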